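(* Let $m\ge 1$ and $n\ge 2$ be integers, let $M=\{1,\dots,m\}$ be a set of items and $N=\{1,\dots,n\}$ a set of agents with linear valuations given by numbers $v_{\ell i}\ge 0$ ($\ell\in M$, $i\in N$). Define the continuous function $f:\mathbb{R}^{mn}\to\mathbb{R}$, for $y=(y_{\ell i})_{\ell\in M,\,i\in N}$, by $$f(y)=\max_{\substack{i,j\in N,\ i\neq j\\ k\in M}}\Big(y_{kj}+\sum_{\ell\in M,\ \ell\neq k}\max\Big\{y_{\ell i}-v_{\ell i},\ y_{\ell j}+v_{\ell i},\ \max_{r\in N\setminus\{i,j\}}y_{\ell r}\Big\}\Big)-\sum_{\ell\in M}\max_{r\in N} y_{\ell r}.$$ Then an EFX allocation exists if and only if $\inf_{y\in\mathbb{R}^{mn}} f(y)\le 0$.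
   Context: Linear valuations: agent $i$ values a set $S\subseteq M$ of items at $v_i(S)=\sum_{k\in S}v_{ki}$, where $v_{ki}\ge 0$ is the value agent $i$ assigns to item $k$. An EFX allocation (envy-free up to any good) is a partition $X=(X_1,\dots,X_n)$ of $M$ (pairwise disjoint, possibly empty sets with union $M$) such that $v_i(X_i)\ge v_i(X_j\setminus\{k\})$ for all $i,j\in N$ and all $k\in X_j$. When $n=2$, the inner term $\max_{r\in N\setminus\{i,j\}}y_{\ell r}$ is a maximum over the empty set and is omitted (i.e. taken to be $-\infty$). *)

theory Defs
  imports "HOL-Analysis.Analysis"
begin

text \<open>
  Items are the elements of a finite type \<open>'m\<close>, agents those of a finite type \<open>'n\<close>; types being
  nonempty, there is always at least one item. \<open>v k i\<close> is the value of item \<open>k\<close> for agent \<open>i\<close>.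
\<close>

definition valuation :: "('m \<Rightarrow> 'n \<Rightarrow> real) \<Rightarrow> 'n \<Rightarrow> 'm set \<Rightarrow> real" where
  "valuation v i S = (\<Sum>k\<in>S. v k i)"

definition is_allocation :: "('n \<Rightarrow> 'm set) \<Rightarrow> bool" where
  "is_allocation X \<longleftrightarrow> disjoint_family X \<and> (\<Union>i. X i) = UNIV"

definition EFX_allocation :: "('m \<Rightarrow> 'n \<Rightarrow> real) \<Rightarrow> ('n \<Rightarrow> 'm set) \<Rightarrow> bool" where
  "EFX_allocation v X \<longleftrightarrow> is_allocation X \<and>
     (\<forall>i j. \<forall>k\<in>X j. valuation v i (X i) \<ge> valuation v i (X j - {k}))"

text \<open>
  The union in the inner maximum contributes nothing when \<open>i\<close> and \<open>j\<close> are the only agents. The outer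
  maximum is over a nonempty set, hence meaningful, only if there are at least two agents.
\<close>

definition EFX_fun ::
    "('m::finite \<Rightarrow> 'n::finite \<Rightarrow> real) \<Rightarrow> real ^ 'n ^ 'm \<Rightarrow> real" where
  "EFX_fun v y =
     Max {y $ k $ j +
          (\<Sum>l\<in>UNIV - {k}.
             Max ({y $ l $ i - v l i, y $ l $ j + v l i} \<union> {y $ l $ r | r. r \<notin> {i, j}}))
         | i j k. i \<noteq> j}
     - (\<Sum>l\<in>UNIV. Max (range (\<lambda>r. y $ l $ r)))"

lemma continuous_on_Max_image:
  fixes g :: "'i \<Rightarrow> 'a::topological_space \<Rightarrow> real"
  assumes "finite I" "I \<noteq> {}" "\<And>i. i \<in> I \<Longrightarrow> continuous_on S (g i)"
  shows "continuous_on S (\<lambda>y. Max ((\<lambda>i. g i y) ` I))"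
  using assms
proof (induction I rule: finite_ne_induct)
  case (insert i I)
  then show ?case by (auto intro!: continuous_on_max)
qed auto

lemma continuous_on_EFX_fun:
  fixes v :: "'m::finite \<Rightarrow> 'n::finite \<Rightarrow> real"
  assumes "CARD('n) \<ge> 2"
  shows "continuous_on UNIV (EFX_fun v)"
proof -
  have inner: "continuous_on UNIV (\<lambda>y :: real ^ 'n ^ 'm.
      Max ({y $ l $ i - v l i, y $ l $ j + v l i} \<union> {y $ l $ r | r. r \<notin> {i, j}}))" for l i j
  proof -
    let ?I = "{(i, - v l i), (j, v l i)} \<union> {(r, 0) | r. r \<notin> {i, j}}"
    have eq: "{y $ l $ i - v l i, y $ l $ j + v l i} \<union> {y $ l $ r | r. r \<notin> {i, j}}
        = (\<lambda>p. y $ l $ fst p + snd p) ` ?I" for y :: "real ^ 'n ^ 'm"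
      by force
    have "continuous_on UNIV (\<lambda>y :: real ^ 'n ^ 'm. Max ((\<lambda>p. y $ l $ fst p + snd p) ` ?I))"
      by (rule continuous_on_Max_image) (auto intro!: continuous_intros)
    then show ?thesis unfolding eq .
  qed
  let ?J = "{(i, j, k) :: 'n \<times> 'n \<times> 'm | i j k. i \<noteq> j}"
  let ?g = "\<lambda>(i, j, k) y. y $ k $ j +
          (\<Sum>l\<in>UNIV - {k}.
             Max ({y $ l $ i - v l i, y $ l $ j + v l i} \<union> {y $ l $ r | r. r \<notin> {i, j}}))"
  have "\<not> is_singleton (UNIV :: 'n set)"
    using assms by (auto simp: is_singleton_altdef)
  then have ne: "?J \<noteq> {}"
    by (auto simp: is_singleton_def)
  have eq: "{y $ k $ j +
          (\<Sum>l\<in>UNIV - {k}.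
             Max ({y $ l $ i - v l i, y $ l $ j + v l i} \<union> {y $ l $ r | r. r \<notin> {i, j}}))
         | i j k. i \<noteq> j} = (\<lambda>p. ?g p y) ` ?J" for y :: "real ^ 'n ^ 'm"
    by force
  have cont: "continuous_on UNIV (?g p)" for p
    unfolding split_beta by (intro continuous_intros inner)
  have "continuous_on UNIV (\<lambda>y :: real ^ 'n ^ 'm. Max ((\<lambda>p. ?g p y) ` ?J))"
    by (rule continuous_on_Max_image[OF finite ne cont])
  moreover have "continuous_on UNIV (\<lambda>y :: real ^ 'n ^ 'm. \<Sum>l\<in>UNIV. Max (range (\<lambda>r. y $ l $ r)))"
    by (intro continuous_on_sum continuous_on_Max_image) (auto intro!: continuous_intros)
  ultimately show ?thesis
    unfolding EFX_fun_def[abs_def] eq by (rule continuous_on_diff)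
qed

end

theory Submission imports Defs begin

text \<open>
  An allocation is a function \<open>a\<close> from items to owners. If \<open>a\<close> sends every item \<open>l\<close> to a maximiser
  of \<open>y $ l\<close>, then each triple \<open>(i, j, k)\<close> with \<open>a k = j \<noteq> i\<close> shows that \<open>EFX_fun v y\<close> is at least the
  envy \<open>v_i(X_j - {k}) - v_i(X_i)\<close>. Hence if no allocation is EFX, \<open>EFX_fun v\<close> is bounded below by the
  least positive envy among the finitely many allocations. Conversely, if \<open>a\<close> is EFX, then
  \<open>EFX_fun v y \<le> 0\<close> for \<open>y $ l $ r = (if a l = r then T else 0)\<close> with \<open>T\<close> large: triples with \<open>a k = j\<close>
  contribute exactly the envy, and all others lose \<open>T\<close>.
\<close>

definition owner_bundles :: "('m \<Rightarrow> 'n) \<Rightarrow> 'n \<Rightarrow> 'm set" where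
  "owner_bundles a i = {l. a l = i}"

definition envy :: "('m \<Rightarrow> 'n \<Rightarrow> real) \<Rightarrow> ('m \<Rightarrow> 'n) \<Rightarrow> 'n \<Rightarrow> 'n \<Rightarrow> 'm \<Rightarrow> real" where
  "envy v a i j k =
     valuation v i (owner_bundles a j - {k}) - valuation v i (owner_bundles a i)"

text \<open>Every item lies in exactly one bundle, so a partition amounts to an owner for each item.
  Quantifying over owner functions turns "some allocation" into a choice from a finite type.\<close>

lemma is_allocation_iff_owner_bundles:
  "is_allocation X \<longleftrightarrow> (\<exists>a. X = owner_bundles a)"
proof
  assume X: "is_allocation X"
  then have "\<forall>l. \<exists>i. l \<in> X i"
    by (auto simp: is_allocation_def)
  then obtain a where a: "\<And>l. l \<in> X (a l)"
    by metis
  have "l \<in> X i \<longleftrightarrow> a l = i" for l i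
    using X a[of l] by (auto simp: is_allocation_def disjoint_family_on_def)
  then show "\<exists>a. X = owner_bundles a"
    by (intro exI[of _ a]) (auto simp: owner_bundles_def fun_eq_iff)
qed (auto simp: is_allocation_def disjoint_family_on_def owner_bundles_def)

text \<open>Values being nonnegative, removing an item from one's own bundle never raises its value,
  so the case \<open>i = j\<close> drops out. This matches the range of the outer maximum.\<close>

lemma EFX_allocation_owner_bundles_iff:
  fixes v :: "'m::finite \<Rightarrow> 'n \<Rightarrow> real"
  assumes "\<And>l i. v l i \<ge> 0"
  shows "EFX_allocation v (owner_bundles a) \<longleftrightarrow>
    (\<forall>i j k. i \<noteq> j \<longrightarrow> a k = j \<longrightarrow> envy v a i j k \<le> 0)"
proof -
  have "valuation v i (owner_bundles a i - {k}) \<le> valuation v i (owner_bundles a i)" for i k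
    unfolding valuation_def using assms by (intro sum_mono2) auto
  then show ?thesis
    unfolding EFX_allocation_def is_allocation_iff_owner_bundles envy_def
    by (simp add: owner_bundles_def) metis
qed

text \<open>As \<open>a k = j \<noteq> i\<close>, item \<open>k\<close> is missing from the bundle
  of \<open>i\<close> too, so both valuations become sums over \<open>UNIV - {k}\<close>, the index
  set used in \<open>outer_term\<close>.\<close>

lemma envy_eq_sum:
  fixes v :: "'m::finite \<Rightarrow> 'n \<Rightarrow> real"
  assumes "i \<noteq> j" "a k = j"
  shows "envy v a i j k =
    (\<Sum>l\<in>UNIV - {k}. if a l = i then - v l i else if a l = j then v l i else 0)"
proof -
  let ?U = "UNIV - {k}"
  have "valuation v i (owner_bundles a j - {k}) = (\<Sum>l\<in>?U. if a l = j then v l i else 0)"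
    unfolding valuation_def owner_bundles_def
    by (subst sum.inter_filter[symmetric]) (auto intro!: sum.cong)
  moreover have "valuation v i (owner_bundles a i) = (\<Sum>l\<in>?U. if a l = i then v l i else 0)"
    unfolding valuation_def owner_bundles_def using assms
    by (subst sum.inter_filter[symmetric]) (auto intro!: sum.cong)
  ultimately show ?thesis
    unfolding envy_def using assms
    by (simp only: sum_subtractf[symmetric]) (auto intro!: sum.cong split: if_splits)
qed

definition inner_max :: "('m \<Rightarrow> 'n::finite \<Rightarrow> real) \<Rightarrow> real ^ 'n ^ 'm \<Rightarrow> 'n \<Rightarrow> 'n \<Rightarrow> 'm \<Rightarrow> real" where
  "inner_max v y i j l =
     Max ({y $ l $ i - v l i, y $ l $ j + v l i} \<union> {y $ l $ r | r. r \<notin> {i, j}})"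

definition outer_term ::
    "('m::finite \<Rightarrow> 'n::finite \<Rightarrow> real) \<Rightarrow> real ^ 'n ^ 'm \<Rightarrow> 'n \<Rightarrow> 'n \<Rightarrow> 'm \<Rightarrow> real" where
  "outer_term v y i j k = y $ k $ j + (\<Sum>l\<in>UNIV - {k}. inner_max v y i j l)"

lemma finite_outer_terms:
  "finite {outer_term v y i j k | i j k. i \<noteq> j}"
proof (rule finite_subset)
  show "{outer_term v y i j k | i j k. i \<noteq> j} \<subseteq> (\<lambda>(i, j, k). outer_term v y i j k) ` UNIV"
    by clarify (rule image_eqI[of _ _ "(i, j, k)" for i j k], auto)
qed simp

lemma EFX_fun_eq:
  "EFX_fun v y = Max {outer_term v y i j k | i j k. i \<noteq> j}
     - (\<Sum>l\<in>UNIV. Max (range (\<lambda>r. y $ l $ r)))"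
  by (simp only: EFX_fun_def outer_term_def inner_max_def)

lemma outer_term_le_EFX_fun:
  assumes "i \<noteq> j"
  shows "outer_term v y i j k - (\<Sum>l\<in>UNIV. Max (range (\<lambda>r. y $ l $ r))) \<le> EFX_fun v y"
  unfolding EFX_fun_eq using assms
  by (intro diff_right_mono Max_ge finite_outer_terms) auto

text \<open>Two distinct agents make the set of outer terms nonempty, so that its \<open>Max\<close>
  is a genuine maximum.\<close>

lemma EFX_fun_le:
  fixes v :: "'m::finite \<Rightarrow> 'n::finite \<Rightarrow> real"
  assumes "CARD('n) \<ge> 2"
    and "\<And>i j k. i \<noteq> j \<Longrightarrow>
      outer_term v y i j k - (\<Sum>l\<in>UNIV. Max (range (\<lambda>r. y $ l $ r))) \<le> c"
  shows "EFX_fun v y \<le> c"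
proof -
  obtain p q :: 'n where "p \<noteq> q"
    using assms(1) by (metis card_2_iff' ex_card UNIV_I)
  then have ne: "{outer_term v y i j k | i j k. i \<noteq> j} \<noteq> {}"
    by blast
  have "Max {outer_term v y i j k | i j k. i \<noteq> j}
      \<le> c + (\<Sum>l\<in>UNIV. Max (range (\<lambda>r. y $ l $ r)))"
    using assms(2) by (subst Max_le_iff[OF finite_outer_terms ne]) (force simp: algebra_simps)
  then show ?thesis
    unfolding EFX_fun_eq by simp
qed

text \<open>Each agent \<open>r\<close> supplies a candidate for the maximum, with an offset
  depending on its role. For \<open>r = a l\<close> the offset is the summand of
  \<open>envy_eq_sum\<close>.\<close>

lemma inner_max_ge:
  assumes "i \<noteq> j"
  shows "inner_max v y i j l \<ge>
    y $ l $ r + (if r = i then - v l i else if r = j then v l i else 0)"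
  unfolding inner_max_def using assms by (intro Max_ge) auto

lemma inner_max_le_iff:
  "inner_max v y i j l \<le> c \<longleftrightarrow>
    y $ l $ i - v l i \<le> c \<and> y $ l $ j + v l i \<le> c \<and> (\<forall>r. r \<notin> {i, j} \<longrightarrow> y $ l $ r \<le> c)"
  unfolding inner_max_def by (subst Max_le_iff) auto

lemma envy_le_EFX_fun:
  fixes v :: "'m::finite \<Rightarrow> 'n::finite \<Rightarrow> real"
  assumes max: "\<And>l. y $ l $ a l = Max (range (\<lambda>r. y $ l $ r))"
    and "i \<noteq> j" "a k = j"
  shows "envy v a i j k \<le> EFX_fun v y"
proof -
  let ?d = "\<lambda>l. if a l = i then - v l i else if a l = j then v l i else 0"
  \<comment> \<open>The maximum for item \<open>k\<close> is \<open>y $ k $ j\<close> because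
    \<open>a k = j\<close>; each other maximum absorbs its summand of the envy.\<close>
  have "(\<Sum>l\<in>UNIV. Max (range (\<lambda>r. y $ l $ r))) + envy v a i j k
      = y $ k $ j + (\<Sum>l\<in>UNIV - {k}. y $ l $ a l + ?d l)"
    unfolding envy_eq_sum[of i j a k v, OF assms(2,3)] max[symmetric] sum.distrib using \<open>a k = j\<close>
    by (subst sum.remove[of UNIV k]) auto
  also have "\<dots> \<le> outer_term v y i j k"
    unfolding outer_term_def using inner_max_ge[OF \<open>i \<noteq> j\<close>]
    by (intro add_left_mono sum_mono) blast
  finally show ?thesis
    using outer_term_le_EFX_fun[OF \<open>i \<noteq> j\<close>, of v y k] by linarith
qed

lemma ex_EFX_fun_le_0:
  fixes v :: "'m::finite \<Rightarrow> 'n::finite \<Rightarrow> real"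
  assumes card: "CARD('n) \<ge> 2" and nonneg: "\<And>l i. v l i \<ge> 0"
    and efx: "EFX_allocation v (owner_bundles a)"
  shows "\<exists>y. EFX_fun v y \<le> 0"
proof -
  \<comment> \<open>The factor 2 serves items owned by \<open>i\<close>: there the candidate
    \<open>v l i\<close> of agent \<open>j\<close> must not exceed the owner's
    \<open>T - v l i\<close>.\<close>
  define T where "T = 2 * (\<Sum>l\<in>UNIV. \<Sum>i\<in>UNIV. v l i)"
  define y :: "real ^ 'n ^ 'm" where "y = (\<chi> l r. if a l = r then T else 0)"
  have y: "y $ l $ r = (if a l = r then T else 0)" for l r
    by (simp add: y_def)
  have agent_sum: "2 * (\<Sum>l\<in>U. v l i) \<le> T" for U i
  proof -
    have "(\<Sum>l\<in>U. v l i) \<le> (\<Sum>l\<in>UNIV. v l i)"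
      using nonneg by (intro sum_mono2) auto
    also have "\<dots> \<le> (\<Sum>l\<in>UNIV. \<Sum>i\<in>UNIV. v l i)"
      using nonneg by (intro sum_mono member_le_sum) auto
    finally show ?thesis
      by (simp add: T_def)
  qed
  have T: "2 * v l i \<le> T" for l i
    using agent_sum[where U = "{l}" and i = i] by simp
  have T0: "T \<ge> 0"
    unfolding T_def using nonneg by (intro mult_nonneg_nonneg sum_nonneg) auto
  have Max_y: "Max (range (\<lambda>r. y $ l $ r)) = T" for l
    using T0 by (intro Max_eqI) (auto simp: y intro!: image_eqI[of _ _ "a l"])
  have inner: "inner_max v y i j l \<le> T + (if a l = i then - v l i else if a l = j then v l i else 0)"
    if "i \<noteq> j" for i j l
    using that T0 T[of l i] nonneg[of l i] by (auto simp: inner_max_le_iff y)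
  have inner': "inner_max v y i j l \<le> T + v l i" if "i \<noteq> j" for i j l
    using inner[OF that, of l] nonneg[of l i] by (auto split: if_splits)
  have "EFX_fun v y \<le> 0"
  proof (rule EFX_fun_le[OF card])
    fix i j :: 'n and k :: 'm
    assume "i \<noteq> j"
    let ?U = "UNIV - {k}"
    have sum_T: "(\<Sum>l\<in>UNIV. Max (range (\<lambda>r. y $ l $ r))) = T + (\<Sum>l\<in>?U. T)"
      unfolding Max_y by (rule sum.remove) auto
    show "outer_term v y i j k - (\<Sum>l\<in>UNIV. Max (range (\<lambda>r. y $ l $ r))) \<le> 0"
    proof (cases "a k = j")
      case True
      let ?d = "\<lambda>l. if a l = i then - v l i else if a l = j then v l i else 0"
      have "outer_term v y i j k \<le> T + (\<Sum>l\<in>?U. T + ?d l)"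
        unfolding outer_term_def using inner[OF \<open>i \<noteq> j\<close>] True
        by (intro add_mono sum_mono) (auto simp: y)
      also have "\<dots> = T + (\<Sum>l\<in>?U. T) + envy v a i j k"
        unfolding envy_eq_sum[of i j a k v, OF \<open>i \<noteq> j\<close> True] sum.distrib by simp
      also have "envy v a i j k \<le> 0"
        using efx \<open>i \<noteq> j\<close> True EFX_allocation_owner_bundles_iff[of v a] nonneg by blast
      finally show ?thesis
        unfolding sum_T by simp
    next
      \<comment> \<open>Here \<open>y $ k $ j = 0\<close>, so the term for \<open>k\<close> is short
        by \<open>T\<close>, while the other items together gain at most the value agent
        \<open>i\<close> puts on them.\<close>
      case False
      have "outer_term v y i j k \<le> 0 + (\<Sum>l\<in>?U. T + v l i)"
        unfolding outer_term_def using inner'[OF \<open>i \<noteq> j\<close>] False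
        by (intro add_mono sum_mono) (auto simp: y)
      then show ?thesis
        unfolding sum_T sum.distrib using agent_sum[where U = ?U and i = i] T0 by linarith
    qed
  qed
  then show ?thesis ..
qed

text \<open>Positivity at each \<open>y\<close> would still permit an infimum of 0, so a bound
  uniform in \<open>y\<close> is required; finiteness of the set of owner functions provides
  it.\<close>

lemma EFX_fun_bounded_below:
  fixes v :: "'m::finite \<Rightarrow> 'n::finite \<Rightarrow> real"
  assumes nonneg: "\<And>l i. v l i \<ge> 0"
    and no_efx: "\<not> (\<exists>X. EFX_allocation v X)"
  shows "\<exists>e>0. \<forall>y. e \<le> EFX_fun v y"
proof -
  have "\<exists>i j k. i \<noteq> j \<and> a k = j \<and> envy v a i j k > 0" for a
    using no_efx EFX_allocation_owner_bundles_iff[of v a] nonneg by force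
  then obtain i j k where ijk:
    "\<And>a. i a \<noteq> j a" "\<And>a. a (k a) = j a" "\<And>a. envy v a (i a) (j a) (k a) > 0"
    by metis
  define e where "e = Min (range (\<lambda>a. envy v a (i a) (j a) (k a)))"
  have "e > 0"
    unfolding e_def using ijk(3) by (subst Min_gr_iff) auto
  moreover have "e \<le> EFX_fun v y" for y
  proof -
    \<comment> \<open>Maxima are attained, so each item can be given to a maximiser; ties are broken
      arbitrarily.\<close>
    have "Max (range (\<lambda>r. y $ l $ r)) \<in> range (\<lambda>r. y $ l $ r)" for l
      by (rule Max_in) auto
    then have "\<exists>r. y $ l $ r = Max (range (\<lambda>r. y $ l $ r))" for l
      by (metis rangeE)
    then obtain a where a: "\<And>l. y $ l $ a l = Max (range (\<lambda>r. y $ l $ r))"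
      by metis
    have "e \<le> envy v a (i a) (j a) (k a)"
      unfolding e_def by (rule Min_le) auto
    also have "\<dots> \<le> EFX_fun v y"
      using a ijk(1,2) by (rule envy_le_EFX_fun)
    finally show ?thesis .
  qed
  ultimately show ?thesis
    by blast
qed

text \<open>The infimum is taken in \<open>ereal\<close>, a complete lattice, so that it is
  meaningful before any lower bound is known.\<close>

theorem theorem3:
  fixes v :: "'m::finite \<Rightarrow> 'n::finite \<Rightarrow> real"
  assumes "CARD('n) \<ge> 2"
    and "\<And>l i. v l i \<ge> 0"
  shows "(\<exists>X. EFX_allocation v X) \<longleftrightarrow> (INF y. ereal (EFX_fun v y)) \<le> 0"
proof
  assume "\<exists>X. EFX_allocation v X"
  then obtain a where "EFX_allocation v (owner_bundles a)"
    by (auto simp: EFX_allocation_def is_allocation_iff_owner_bundles)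
  then obtain y where "EFX_fun v y \<le> 0"
    using ex_EFX_fun_le_0 assms by blast
  then show "(INF y. ereal (EFX_fun v y)) \<le> 0"
    by (intro INF_lower2[of y]) auto
next
  assume inf: "(INF y. ereal (EFX_fun v y)) \<le> 0"
  show "\<exists>X. EFX_allocation v X"
  proof (rule ccontr)
    assume "\<not> (\<exists>X. EFX_allocation v X)"
    then obtain e where "e > 0" "\<And>y. e \<le> EFX_fun v y"
      using EFX_fun_bounded_below[of v] assms(2) by blast
    then have "ereal e \<le> (INF y. ereal (EFX_fun v y))"
      by (intro INF_greatest) simp
    with inf have "ereal e \<le> 0"
      by (rule order_trans[rotated])
    with \<open>e > 0\<close> show False
      by simp
  qed
qed

end
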